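(* For any integers $1\le n\le m$, the parabolic stability radius satisfies $\theta_{m,n}\ge -\eta$, where $\eta$ is the unique negative zero of the polynomial equation $$\mathcal{L}^{(-m-1)}_{n}(x)-\binom{m}{n}=0 .$$
   Context: For integers $0\le n\le m$, $\Pi_{m,n}$ is the class of polynomials $P(z)=\sum_{k=0}^m \alpha_k \frac{z^k}{k!}$ with $\alpha_0=\dots=\alpha_n=1$. For a real polynomial $P\in\Pi_{m,n}$ set $\theta(P)=\sup\{r>0 : |P(x)|\le 1 \text{ for all } x\in[-r,0]\}$; the parabolic stability radius $\theta_{m,n}$ is the supremum of $\theta(P)$ over all real polynomials $P\in\Pi_{m,n}$. For any real $\gamma$ (including negative values), the generalized Laguerre polynomial is defined by $\mathcal{L}_n^{(\gamma)}(x)=\sum_{\ell=0}^n\binom{n+\gamma}{n-\ell}\frac{(-x)^\ell}{\ell!}$, where $\binom{t}{\ell}=\frac{t(t-1)\cdots(t-\ell+1)}{\ell!}$ for $\ell>0$ and $\binom{t}{0}=1$. *)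

theory Defs
  imports
    Complex_Main
    "HOL-Library.Extended_Real"
    "HOL-Computational_Algebra.Polynomial"
begin

definition Pi_class :: "nat \<Rightarrow> nat \<Rightarrow> 'a::field_char_0 poly set" where
  "Pi_class m n =
     {P. \<exists>\<alpha>. P = (\<Sum>k\<le>m. monom (\<alpha> k / fact k) k) \<and> (\<forall>k\<le>n. \<alpha> k = 1)}"

(* Both suprema are taken in the extended reals, so that an unbounded set yields
   infinity rather than the unspecified value of Sup on the reals: a constant P, which
   lies in Pi_class m 0, has infinite threshold. For P in Pi_class m n with 1 <= n <= m
   the set of admissible r is nonempty, as P(0) = P'(0) = 1. *)
definition stability_threshold :: "real poly \<Rightarrow> ereal" where
  "stability_threshold P = Sup {ereal r | r. r > 0 \<and> (\<forall>x\<in>{-r..0}. \<bar>poly P x\<bar> \<le> 1)}"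

definition parabolic_stability_radius :: "nat \<Rightarrow> nat \<Rightarrow> ereal" where
  "parabolic_stability_radius m n = (SUP P \<in> Pi_class m n. stability_threshold P)"

definition gen_laguerre :: "nat \<Rightarrow> real \<Rightarrow> real \<Rightarrow> real" where
  "gen_laguerre n \<gamma> x =
     (\<Sum>l\<le>n. ((real n + \<gamma>) gchoose (n - l)) * ((- x) ^ l / fact l))"

end

theory Submission
  imports Defs "HOL-Computational_Algebra.Formal_Power_Series"
begin

text \<open>
  Write \<open>r = - x\<close> and let \<open>V\<^sub>j(r)\<close> be the polynomial obtained from the generalized Laguerre
  polynomial of degree \<open>j\<close> and parameter \<open>- m - 1\<close> by this reflection. On the interval \<open>[- r, 0]\<close>,
  with \<open>s = - x / r\<close>, the Bernstein form of degree \<open>m\<close> of a polynomial is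

    \<open>P(x) = (\<Sum>j\<le>m. b\<^sub>j * (m choose j) * s ^ j * (1 - s) ^ (m - j))\<close>,

  and \<open>\<bar>P\<bar> \<le> 1\<close> there as soon as all \<open>b\<^sub>j\<close> lie in \<open>[- 1, 1]\<close>. The Taylor coefficients of \<open>P\<close> at \<open>0\<close>
  up to order \<open>n\<close> agree with those of the exponential function exactly when
  \<open>b\<^sub>j * (m choose j) = (- 1) ^ j * V\<^sub>j(r)\<close> for all \<open>j \<le> n\<close>; the other \<open>b\<^sub>j\<close> are free, and they are
  taken to be \<open>0\<close>. So the equation of the theorem says that the last prescribed Bernstein
  coefficient has reached the boundary value \<open>(- 1) ^ n\<close>, and the lower bound follows once the
  earlier ones are known to be at most \<open>1\<close> in modulus at this \<open>r\<close>
  (\<open>refl_laguerre_abs_le_before_zero\<close>).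

  This rests on three estimates, each obtained from the identities satisfied by the coefficients of
  \<open>exp (r * z) * (1 + z) powr (- K)\<close>. For all \<open>r \<ge> 0\<close> one has \<open>V\<^sub>j(r) \<ge> - (m choose j)\<close>
  (\<open>refl_laguerre_ge\<close>). For \<open>r \<le> 2 * (m - j + 1)\<close> one has \<open>\<bar>V\<^sub>j(r)\<bar> \<le> (m choose j)\<close>
  (\<open>refl_laguerre_abs_le\<close>). For \<open>r \<ge> 2 * (m - j)\<close> the condition \<open>V\<^sub>j(r) \<ge> c * (m choose j)\<close> with
  \<open>c \<ge> 1\<close> is inherited by all indices from \<open>j\<close> to \<open>m\<close> (\<open>refl_laguerre_growth\<close>). Hence, if some \<open>V\<^sub>j(r)\<close> with
  \<open>j < n\<close> exceeded \<open>(m choose j)\<close>, then \<open>r\<close> would lie in the growth range and \<open>V\<^sub>n(r)\<close> would exceed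
  \<open>(m choose n)\<close>, contrary to the equation.

  The zero exists because the growth estimate, started at \<open>j = 0\<close>, gives
  \<open>V\<^sub>n(2 * m) \<ge> (m choose n)\<close>. It is unique because \<open>V\<^sub>n\<close> is increasing on \<open>[0, \<infinity>)\<close> for odd \<open>n\<close>,
  while for even \<open>n\<close> it starts at \<open>(m choose n)\<close> and is strictly convex there.
\<close>

section \<open>Reflected Laguerre polynomials and their generating function\<close>

text \<open>
  This is the generalized Laguerre polynomial of degree \<open>n\<close> and parameter \<open>- K - n\<close> at \<open>- r\<close>. The
  sum \<open>K\<close> of the degree and the parameter, up to sign, is the natural second index: for fixed \<open>K\<close>
  there is a simple generating function, and differentiation in \<open>r\<close> keeps \<open>K\<close> fixed. The family
  with parameter \<open>- m - 1\<close> consists of the pairs with \<open>K + n = m + 1\<close>.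
\<close>
definition refl_laguerre :: "nat \<Rightarrow> nat \<Rightarrow> real \<Rightarrow> real" where
  "refl_laguerre K n r = (\<Sum>l\<le>n. ((- real K) gchoose (n - l)) * (r ^ l / fact l))"

lemma gen_laguerre_eq_refl_laguerre:
  assumes "n \<le> m"
  shows "gen_laguerre n (- real m - 1) x = refl_laguerre (Suc (m - n)) n (- x)"
proof -
  have "real n + (- real m - 1) = - real (Suc (m - n))"
    using assms by linarith
  then show ?thesis
    by (simp only: gen_laguerre_def refl_laguerre_def)
qed

text \<open>
  In this form all binomial coefficients are natural numbers and, up to the outer sign, the
  polynomial is the one that the Bernstein coefficients of the exponential series produce.
\<close>
lemma refl_laguerre_binomial_sum:
  "refl_laguerre (Suc k) j r =
     (-1) ^ j * (\<Sum>l\<le>j. real ((k + j - l) choose (j - l)) * ((- r) ^ l / fact l))"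
proof -
  have "((- real (Suc k)) gchoose (j - l)) * (r ^ l / fact l) =
        (-1) ^ j * (real ((k + j - l) choose (j - l)) * ((- r) ^ l / fact l))" if "l \<le> j" for l
  proof -
    have e: "real (j - l) - (- real (Suc k)) - 1 = real (k + j - l)"
      using that by linarith
    have "(- real (Suc k)) gchoose (j - l) = (-1) ^ (j - l) * real ((k + j - l) choose (j - l))"
      by (subst gbinomial_negated_upper) (simp only: e binomial_gbinomial)
    moreover have "(-1::real) ^ j * (- r) ^ l = (-1) ^ (j - l) * r ^ l"
    proof -
      have "(-1::real) ^ j * (- r) ^ l = (-1) ^ (j - l) * ((-1) ^ l * (- r) ^ l)"
        using that by (simp only: mult.assoc[symmetric] power_add[symmetric] le_add_diff_inverse2)
      also have "(-1) ^ l * (- r) ^ l = (- 1 * - r) ^ l"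
        by (rule power_mult_distrib[symmetric])
      finally show ?thesis by simp
    qed
    ultimately show ?thesis
      by (metis (no_types, lifting) mult.assoc mult.commute times_divide_eq_right)
  qed
  then show ?thesis
    unfolding refl_laguerre_def sum_distrib_left by (intro sum.cong) auto
qed

lemma refl_laguerre_0_right [simp]: "refl_laguerre K 0 r = 1"
  by (simp add: refl_laguerre_def)

lemma refl_laguerre_at_0: "refl_laguerre (Suc k) j 0 = (-1) ^ j * real ((k + j) choose j)"
proof -
  have "(\<Sum>l\<le>j. real ((k + j - l) choose (j - l)) * ((- 0) ^ l / fact l)) =
        (\<Sum>l\<in>{0}. real ((k + j - l) choose (j - l)) * ((- 0) ^ l / fact l))"
    by (rule sum.mono_neutral_right) (auto simp: power_0_left)
  then show ?thesis
    by (simp add: refl_laguerre_binomial_sum)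
qed

lemma refl_laguerre_0_left: "refl_laguerre 0 j r = r ^ j / fact j"
proof -
  have "refl_laguerre 0 j r = (\<Sum>l\<in>{j}. ((- real 0) gchoose (j - l)) * (r ^ l / fact l))"
    unfolding refl_laguerre_def
    by (rule sum.mono_neutral_right) (auto simp: gbinomial_0_left)
  then show ?thesis by simp
qed

definition refl_laguerre_fps :: "nat \<Rightarrow> real \<Rightarrow> real fps" where
  "refl_laguerre_fps K r = fps_exp r * fps_binomial (- real K)"

lemma refl_laguerre_fps_nth: "fps_nth (refl_laguerre_fps K r) n = refl_laguerre K n r"
  by (simp add: refl_laguerre_fps_def refl_laguerre_def fps_mult_nth atLeast0AtMost mult.commute)

text \<open>
  The generating function is \<open>exp (r * z) / (1 + z) ^ K\<close>, so raising \<open>K\<close> divides it by \<open>1 + z\<close>. This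
  and the formula for its derivative in \<open>z\<close> give the two identities below.
\<close>
lemma refl_laguerre_fps_step: "refl_laguerre_fps K r = (1 + fps_X) * refl_laguerre_fps (Suc K) r"
proof -
  have "fps_binomial (- real K) = fps_binomial (1 + (- real (Suc K)))"
    by simp
  also have "\<dots> = fps_binomial 1 * fps_binomial (- real (Suc K))"
    by (rule fps_binomial_add_mult)
  finally show ?thesis
    by (simp add: refl_laguerre_fps_def fps_binomial_1 mult_ac)
qed

lemma refl_laguerre_pascal:
  "refl_laguerre K (Suc j) r = refl_laguerre (Suc K) (Suc j) r + refl_laguerre (Suc K) j r"
  using arg_cong[OF refl_laguerre_fps_step[of K r], of "\<lambda>F. fps_nth F (Suc j)"]
  by (simp add: refl_laguerre_fps_nth distrib_right)

lemma refl_laguerre_contiguous: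
  "real (Suc j) * refl_laguerre K (Suc j) r + real K * refl_laguerre (Suc K) j r
     = r * refl_laguerre K j r"
proof -
  have step: "fps_binomial (- real K) = (1 + fps_X) * fps_binomial (- real (Suc K))"
    using refl_laguerre_fps_step[of K 0] by (simp add: refl_laguerre_fps_def)
  have "fps_deriv (fps_binomial (- real K)) =
      fps_const (- real K) * ((1 + fps_X) * fps_binomial (- real (Suc K))) / (1 + fps_X)"
    by (simp only: fps_binomial_deriv flip: step)
  also have "\<dots> = (1 + fps_X) * (fps_const (- real K) * fps_binomial (- real (Suc K))) / (1 + fps_X)"
    by (simp only: mult_ac)
  also have "\<dots> = fps_const (- real K) * fps_binomial (- real (Suc K))"
    by (rule nonzero_mult_div_cancel_left) (auto simp: fps_eq_iff intro!: exI[of _ 0])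
  finally have "fps_deriv (fps_binomial (- real K)) = fps_const (- real K) * fps_binomial (- real (Suc K))" .
  then have "fps_deriv (refl_laguerre_fps K r) =
      fps_const r * refl_laguerre_fps K r + fps_const (- real K) * refl_laguerre_fps (Suc K) r"
    by (simp add: refl_laguerre_fps_def algebra_simps)
  from arg_cong[OF this, of "\<lambda>F. fps_nth F j"] show ?thesis
    by (simp add: refl_laguerre_fps_nth)
qed

text \<open>Differentiating the generating function in \<open>r\<close> multiplies it by \<open>z\<close>.\<close>
lemma refl_laguerre_deriv:
  "((\<lambda>r. refl_laguerre K (Suc j) r) has_real_derivative refl_laguerre K j r) (at r within S)"
proof -
  have "refl_laguerre K (Suc j) = (\<lambda>r. ((- real K) gchoose Suc j) +
          (\<Sum>l\<le>j. ((- real K) gchoose (j - l)) * (r ^ Suc l / fact (Suc l))))"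
    by (simp add: fun_eq_iff refl_laguerre_def sum.atMost_Suc_shift del: sum.atMost_Suc)
  moreover have "((\<lambda>r. r ^ Suc l / fact (Suc l)) has_real_derivative r ^ l / fact l) (at r within S)"
    for l
    by (rule derivative_eq_intros refl | simp add: field_simps del: of_nat_Suc)+
  ultimately show ?thesis
    unfolding refl_laguerre_def[of K j]
    by (simp only:) (intro DERIV_sum DERIV_cmult DERIV_add[OF DERIV_const, simplified])
qed

lemma refl_laguerre_cont: "continuous_on S (refl_laguerre K j)"
  unfolding refl_laguerre_def by (intro continuous_intros) auto

section \<open>Sign, monotonicity and size\<close>

text \<open>
  Since differentiation lowers the degree index by one, \<open>refl_laguerre_pascal\<close> says that the
  polynomial with index \<open>K\<close> is the sum of the one with index \<open>Suc K\<close> and its derivative. Hence \<open>exp t * refl_laguerre (Suc K) j t\<close> has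
  derivative \<open>exp t * refl_laguerre K j t\<close>, and positivity passes from \<open>K\<close> to \<open>Suc K\<close>. The
  induction on \<open>K\<close> starts from the monomials of \<open>refl_laguerre_0_left\<close>.
\<close>
lemma refl_laguerre_pos_step:
  assumes nonneg: "\<And>t. 0 \<le> t \<Longrightarrow> 0 \<le> refl_laguerre K j t"
    and "even j" "0 \<le> r"
  shows "0 < refl_laguerre (Suc K) j r"
proof -
  have deriv: "((\<lambda>t. exp t * refl_laguerre (Suc K) j t) has_real_derivative
           exp t * refl_laguerre K j t) (at t)" for t
  proof (cases j)
    case 0
    then show ?thesis by (auto intro!: derivative_eq_intros)
  next
    case (Suc i)
    have "((\<lambda>t. exp t * refl_laguerre (Suc K) (Suc i) t) has_real_derivative
           exp t * refl_laguerre (Suc K) i t + exp t * refl_laguerre (Suc K) (Suc i) t) (at t)"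
      by (rule derivative_eq_intros refl_laguerre_deriv refl | simp)+
    then show ?thesis
      by (simp add: Suc refl_laguerre_pascal[of K] distrib_left add.commute)
  qed
  have "exp 0 * refl_laguerre (Suc K) j 0 \<le> exp r * refl_laguerre (Suc K) j r"
  proof (rule DERIV_nonneg_imp_nondecreasing[where f = "\<lambda>t. exp t * refl_laguerre (Suc K) j t"])
    show "0 \<le> r" by fact
    show "\<exists>y. ((\<lambda>t. exp t * refl_laguerre (Suc K) j t) has_real_derivative y) (at t) \<and> 0 \<le> y"
      if "0 \<le> t" for t
      using deriv[of t] nonneg[OF that] by (auto intro!: exI[of _ "exp t * refl_laguerre K j t"])
  qed
  moreover have "0 < refl_laguerre (Suc K) j 0"
    using \<open>even j\<close> by (simp add: refl_laguerre_at_0)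
  ultimately have "0 < exp r * refl_laguerre (Suc K) j r"
    by simp
  then show ?thesis
    by (simp add: zero_less_mult_iff)
qed

lemma refl_laguerre_pos_if_even:
  assumes "even j" "0 \<le> r"
  shows "0 < refl_laguerre (Suc K) j r"
  using assms(2)
proof (induction K arbitrary: r)
  case 0
  show ?case
    by (rule refl_laguerre_pos_step) (use assms(1) 0 in \<open>auto simp: refl_laguerre_0_left\<close>)
next
  case (Suc K)
  show ?case
    by (rule refl_laguerre_pos_step) (use assms(1) Suc in \<open>auto intro: less_imp_le\<close>)
qed

lemma refl_laguerre_odd_strict_mono:
  assumes "odd j" "0 \<le> a" "a < b"
  shows "refl_laguerre (Suc K) j a < refl_laguerre (Suc K) j b"
proof -
  obtain i where j: "j = Suc i" "even i"
    using \<open>odd j\<close> by (cases j) auto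
  show ?thesis
    unfolding j(1)
  proof (rule DERIV_pos_imp_increasing[OF \<open>a < b\<close>])
    show "\<exists>y. ((\<lambda>r. refl_laguerre (Suc K) (Suc i) r) has_real_derivative y) (at t) \<and> 0 < y"
      if "a \<le> t" for t
      using refl_laguerre_deriv refl_laguerre_pos_if_even[OF j(2), of t K] that \<open>0 \<le> a\<close> by fastforce
  qed
qed

lemma refl_laguerre_ge:
  assumes "0 \<le> r"
  shows "- real ((k + j) choose j) \<le> refl_laguerre (Suc k) j r"
proof (cases "even j")
  case True
  then show ?thesis
    using refl_laguerre_pos_if_even[OF True assms, of k] by linarith
next
  case False
  then have "refl_laguerre (Suc k) j 0 \<le> refl_laguerre (Suc k) j r"
    using refl_laguerre_odd_strict_mono[OF False, of 0 r k] assms by (cases "r = 0") auto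
  then show ?thesis
    using False by (simp add: refl_laguerre_at_0)
qed

text \<open>
  The logarithms of \<open>exp (r * z) / (1 + z) ^ K\<close> and \<open>1 / (1 - z) ^ K\<close> differ, apart from signs of
  coefficients, only in the coefficient of \<open>z\<close>, which is \<open>r - K\<close> and \<open>K\<close> respectively. So for
  \<open>\<bar>r - K\<bar> \<le> K\<close> the second series majorizes the first, and its coefficients are the binomial
  coefficients of the claim. The induction carries this out on coefficients, with \<open>K = Suc k\<close>.
\<close>
lemma refl_laguerre_abs_le:
  assumes "0 \<le> r" "r \<le> 2 * real (Suc k)"
  shows "\<bar>refl_laguerre (Suc k) j r\<bar> \<le> real ((k + j) choose j)"
  using assms
proof (induction j arbitrary: k rule: less_induct)
  case (less j)
  show ?case
  proof (cases j)
    case 0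
    then show ?thesis by simp
  next
    case (Suc i)
    define K where "K = real (Suc k)"
    \<comment> \<open>By the Pascal identity \<open>d\<close> has index \<open>Suc (Suc k)\<close> and degree \<open>i - 1\<close>, or vanishes when
        \<open>i = 0\<close>; so the induction hypothesis covers it, with the weaker condition on \<open>r\<close>.\<close>
    define d where "d = refl_laguerre (Suc k) i r - refl_laguerre (Suc (Suc k)) i r"
    have main: "\<bar>refl_laguerre (Suc k) i r\<bar> \<le> real ((k + i) choose i)"
      using less Suc by auto
    have d: "\<bar>d\<bar> \<le> real ((k + i) choose Suc k)"
    proof (cases i)
      case 0
      then show ?thesis by (simp add: d_def)
    next
      case (Suc h)
      have "d = refl_laguerre (Suc (Suc k)) h r"
        unfolding d_def Suc refl_laguerre_pascal[of "Suc k"] by simp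
      moreover have "\<bar>refl_laguerre (Suc (Suc k)) h r\<bar> \<le> real ((Suc k + h) choose h)"
        using less.prems Suc \<open>j = Suc i\<close> by (intro less.IH) auto
      moreover have "((Suc k + h) choose h) = ((k + i) choose Suc k)"
        using binomial_symmetric[of "Suc k" "Suc k + h"] Suc by simp
      ultimately show ?thesis by simp
    qed
    have "real (Suc i) * refl_laguerre (Suc k) (Suc i) r = (r - K) * refl_laguerre (Suc k) i r + K * d"
      using refl_laguerre_contiguous[of i "Suc k" r] by (simp add: K_def d_def algebra_simps)
    also have "\<bar>\<dots>\<bar> \<le> \<bar>r - K\<bar> * \<bar>refl_laguerre (Suc k) i r\<bar> + K * \<bar>d\<bar>"
      by (intro order.trans[OF abs_triangle_ineq]) (simp add: abs_mult K_def)
    also have "\<dots> \<le> K * real ((k + i) choose i) + K * real ((k + i) choose Suc k)"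
      using less.prems main d by (intro add_mono mult_mono) (auto simp: K_def)
    also have "\<dots> = K * real (Suc (k + i) choose Suc k)"
      using binomial_symmetric[of k "k + i"] by (simp add: algebra_simps)
    also have "\<dots> = real (Suc i) * real ((k + Suc i) choose Suc i)"
    proof -
      have "Suc k * (Suc (k + i) choose Suc k) = Suc (k + i) * ((k + i) choose k)"
        by (rule Suc_times_binomial)
      also have "((k + i) choose k) = ((k + i) choose i)"
        using binomial_symmetric[of k "k + i"] by simp
      also have "Suc (k + i) * ((k + i) choose i) = Suc i * (Suc (k + i) choose Suc i)"
        by (rule Suc_times_binomial[symmetric])
      finally show ?thesis
        unfolding K_def by (metis add_Suc_right of_nat_mult)
    qed
    finally show ?thesis
      by (simp add: Suc abs_mult del: of_nat_Suc binomial_Suc_Suc)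
  qed
qed

text \<open>
  With \<open>k = m - j\<close> and \<open>B\<^sub>i\<close> the quotient of \<open>refl_laguerre (Suc (m - i)) i r\<close> by \<open>m choose i\<close>, the
  two identities combine to the three-term recurrence

    \<open>(m - j) * (B\<^bsub>j + 1\<^esub> + B\<^sub>j) = r * B\<^sub>j + j * (B\<^sub>j + B\<^bsub>j - 1\<^esub>)\<close>.

  If \<open>B\<^sub>j \<ge> 1\<close>, then the last term is nonnegative because \<open>B\<^bsub>j - 1\<^esub> \<ge> - 1\<close>; if also
  \<open>r \<ge> 2 * (m - j)\<close>, then \<open>B\<^bsub>j + 1\<^esub> \<ge> B\<^sub>j\<close>. The statement carries a factor \<open>c\<close> so that one argument
  serves both \<open>B\<^sub>j = 1\<close>, for the existence of the zero, and \<open>B\<^sub>j > 1\<close>, for the bound before it.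
\<close>
lemma refl_laguerre_growth_step:
  assumes c: "1 \<le> c" and r: "2 * real k \<le> r"
    and V: "c * real ((k + j) choose j) \<le> refl_laguerre (Suc k) j r"
  shows "c * real ((k + j) choose Suc j) \<le> refl_laguerre k (Suc j) r"
proof -
  define C where "C = real ((k + j) choose j)"
  define V where "V = refl_laguerre (Suc k) j r"
  have "0 \<le> r" using r by linarith
  have cC: "c * C \<le> V" "0 \<le> C" using V by (auto simp: C_def V_def)
  then have CV: "C \<le> V"
    using mult_right_mono[OF c cC(2)] by simp
  have low: "r * (refl_laguerre k j r - V) \<ge> real j * (V - C)"
  proof (cases j)
    case 0
    then show ?thesis by (simp add: V_def)
  next
    case (Suc i)
    have "r * (refl_laguerre k j r - V) = r * refl_laguerre (Suc k) i r"
      unfolding V_def Suc refl_laguerre_pascal[of k] by simp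
    also have "\<dots> = real j * V + real (Suc k) * refl_laguerre (Suc (Suc k)) i r"
      using refl_laguerre_contiguous[of i "Suc k" r] by (simp add: V_def Suc)
    also have "real (Suc k) * refl_laguerre (Suc (Suc k)) i r
        \<ge> real (Suc k) * (- real ((Suc k + i) choose i))"
      by (intro mult_left_mono refl_laguerre_ge \<open>0 \<le> r\<close>) auto
    moreover have "real (Suc k) * real ((Suc k + i) choose i) = real j * C"
      using Suc_times_binomial_add[of i k] unfolding C_def Suc
      by (simp only: of_nat_mult[symmetric] add_Suc add_Suc_right add.commute)
    ultimately show ?thesis by (simp add: algebra_simps)
  qed
  have "real (Suc j) * (c * real ((k + j) choose Suc j)) = c * (real k * C)"
  proof -
    have "Suc j * ((k + j) choose Suc j) = k * ((k + j) choose j)"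
      using Suc_times_binomial_add[of j "k - 1"] by (cases k) (auto simp: add.commute)
    then have "real (Suc j) * real ((k + j) choose Suc j) = real k * C"
      unfolding C_def by (simp only: of_nat_mult[symmetric])
    then show ?thesis
      by (simp only: mult.left_commute)
  qed
  also have "\<dots> \<le> real k * V"
    using mult_left_mono[OF cC(1), of "real k"] by (simp add: mult_ac)
  also have "\<dots> \<le> (r - real k) * V + real j * (V - C)"
    using r CV cC by (intro add_increasing2 mult_right_mono mult_nonneg_nonneg) auto
  also have "\<dots> \<le> real (Suc j) * refl_laguerre k (Suc j) r"
    using low refl_laguerre_contiguous[of j k r] by (simp add: V_def algebra_simps)
  finally show ?thesis
    by (simp add: mult_le_cancel_left del: of_nat_Suc)
qed

lemma refl_laguerre_growth:
  assumes c: "1 \<le> c" and r: "2 * real (m - j) \<le> r"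
    and V: "c * real (m choose j) \<le> refl_laguerre (Suc (m - j)) j r"
    and "j \<le> n" "n \<le> m"
  shows "c * real (m choose n) \<le> refl_laguerre (Suc (m - n)) n r"
  using \<open>j \<le> n\<close> \<open>n \<le> m\<close>
proof (induction n rule: dec_induct)
  case base
  show ?case using V .
next
  case (step i)
  then have e: "Suc (m - Suc i) = m - i" "m - i + i = m" by auto
  have "2 * real (m - i) \<le> r"
    using r step by linarith
  from refl_laguerre_growth_step[OF c this, of i] step e show ?case by simp
qed

section \<open>The zero of the equation\<close>

text \<open>
  Growth from \<open>B\<^sub>0 = 1\<close> makes the value at \<open>2 * m\<close> at least \<open>m choose n\<close>, so by the intermediate
  value theorem it is enough to find a smaller value further left. For odd \<open>n\<close> the value at \<open>0\<close> is
  negative. For even \<open>n\<close> the point \<open>0\<close> is itself a solution, but the derivative there is negative.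
\<close>
lemma refl_laguerre_eq_binomial_exists:
  assumes "1 \<le> n" "n \<le> m"
  shows "\<exists>r>0. refl_laguerre (Suc (m - n)) n r = real (m choose n)"
proof -
  let ?V = "refl_laguerre (Suc (m - n)) n"
  have at_0: "refl_laguerre (Suc (m - n)) i 0 = (-1) ^ i * real ((m - n + i) choose i)" for i
    by (rule refl_laguerre_at_0)
  have hi: "real (m choose n) \<le> ?V (2 * real m)"
    using refl_laguerre_growth[of 1 m 0 "2 * real m" n] assms by simp
  have "\<exists>a\<ge>0. a < 2 * real m \<and> ?V a < real (m choose n)"
  proof (cases "even n")
    case False
    then show ?thesis
      using assms at_0[of n] by (intro exI[of _ 0]) (auto simp: not_less)
  next
    case True
    then obtain i where i: "n = Suc i" "odd i"
      using assms(1) by (cases n) auto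
    have "refl_laguerre (Suc (m - n)) i 0 < 0"
      using i(2) by (simp add: at_0)
    then obtain d where d: "d > 0" "\<And>h. \<lbrakk>0 < h; h < d\<rbrakk> \<Longrightarrow> ?V (0 + h) < ?V 0"
      using DERIV_neg_dec_right[OF refl_laguerre_deriv[of "Suc (m - n)" i 0 UNIV]] i(1) by blast
    have "?V 0 = real (m choose n)"
      using at_0[of n] True assms by simp
    moreover have "?V (0 + min (d / 2) (real m)) < ?V 0"
      using d(1) assms by (intro d(2)) auto
    ultimately show ?thesis
      using d(1) assms by (intro exI[of _ "min (d / 2) (real m)"]) auto
  qed
  then obtain a where a: "0 \<le> a" "a < 2 * real m" "?V a < real (m choose n)"
    by blast
  then obtain r where "a \<le> r" "?V r = real (m choose n)"
    using IVT'[of ?V a "real (m choose n)" "2 * real m"] hi refl_laguerre_cont by auto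
  then show ?thesis
    using a by (intro exI[of _ r]) (cases "a = r", auto)
qed

lemma refl_laguerre_rolle:
  assumes "a < b" "refl_laguerre K (Suc i) a = refl_laguerre K (Suc i) b"
  shows "\<exists>z. a < z \<and> z < b \<and> refl_laguerre K i z = 0"
proof -
  obtain z where "a < z" "z < b"
      "refl_laguerre K (Suc i) b - refl_laguerre K (Suc i) a = (b - a) * refl_laguerre K i z"
    using MVT2[OF \<open>a < b\<close>, of "refl_laguerre K (Suc i)" "refl_laguerre K i"] refl_laguerre_deriv
    by blast
  then show ?thesis
    using assms by auto
qed

text \<open>
  For even \<open>n\<close> the value \<open>m choose n\<close> is also taken at \<open>0\<close>, so two positive solutions would give two
  zeros of the derivative, which has odd degree and is therefore strictly increasing.
\<close>
lemma refl_laguerre_eq_binomial_unique: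
  assumes "1 \<le> n" "n \<le> m" "0 < a" "a < b"
    and a: "refl_laguerre (Suc (m - n)) n a = real (m choose n)"
    and b: "refl_laguerre (Suc (m - n)) n b = real (m choose n)"
  shows False
proof (cases "even n")
  case False
  then show False
    using refl_laguerre_odd_strict_mono[OF False, of a b "m - n"] assms by auto
next
  case True
  then obtain i where i: "n = Suc i" "odd i"
    using assms(1) by (cases n) auto
  have "refl_laguerre (Suc (m - n)) n 0 = real (m choose n)"
    using refl_laguerre_at_0[of "m - n" n] True assms by simp
  then obtain y where y: "0 < y" "y < a" "refl_laguerre (Suc (m - n)) i y = 0"
    using refl_laguerre_rolle[of 0 a "Suc (m - n)" i] a i \<open>0 < a\<close> by auto
  obtain z where z: "a < z" "refl_laguerre (Suc (m - n)) i z = 0"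
    using refl_laguerre_rolle[of a b "Suc (m - n)" i] a b i \<open>a < b\<close> by auto
  show False
    using refl_laguerre_odd_strict_mono[OF i(2), of y z "m - n"] y z by auto
qed

text \<open>
  The ranges of the majorization and of the growth estimate overlap, so every \<open>r\<close> is covered: either
  the bound holds outright, or an excess at \<open>j\<close> would propagate to an excess at \<open>n\<close>.
\<close>
lemma refl_laguerre_abs_le_before_zero:
  assumes "j \<le> n" "n \<le> m" "0 < r"
    and eq: "refl_laguerre (Suc (m - n)) n r = real (m choose n)"
  shows "\<bar>refl_laguerre (Suc (m - j)) j r\<bar> \<le> real (m choose j)"
proof (cases "r \<le> 2 * real (Suc (m - j))")
  case True
  then show ?thesis
    using refl_laguerre_abs_le[of r "m - j" j] assms by simp
next
  case False
  have "refl_laguerre (Suc (m - j)) j r \<le> real (m choose j)"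
  proof (rule ccontr)
    assume gt: "\<not> refl_laguerre (Suc (m - j)) j r \<le> real (m choose j)"
    define c where "c = refl_laguerre (Suc (m - j)) j r / real (m choose j)"
    have pos: "0 < real (m choose j)" "0 < real (m choose n)"
      using assms by auto
    have c: "1 < c" "c * real (m choose j) = refl_laguerre (Suc (m - j)) j r"
      using gt pos(1) by (simp_all add: c_def less_divide_eq)
    have "2 * real (m - j) \<le> r"
      using False by simp
    then have "c * real (m choose n) \<le> refl_laguerre (Suc (m - n)) n r"
      using refl_laguerre_growth[of c m j r n] less_imp_le[OF c(1)] eq_refl[OF c(2)] assms(1,2)
      by blast
    also have "\<dots> = 1 * real (m choose n)"
      using eq by simp
    finally show False
      using c(1) pos(2) by (simp only: mult_le_cancel_right not_less[symmetric]) simp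
  qed
  moreover have "- real (m choose j) \<le> refl_laguerre (Suc (m - j)) j r"
    using refl_laguerre_ge[of r "m - j" j] assms by simp
  ultimately show ?thesis by linarith
qed

section \<open>The extremal polynomial in Bernstein form\<close>

text \<open>Expand the last factor of \<open>S ^ l = S ^ l * (S + (1 - S)) ^ (m - l)\<close>.\<close>
lemma monomial_bernstein_expansion:
  fixes S :: "'a::comm_ring_1"
  assumes "l \<le> m"
  shows "S ^ l = (\<Sum>j\<in>{l..m}. of_nat ((m - l) choose (j - l)) * (S ^ j * (1 - S) ^ (m - j)))"
proof -
  have "S ^ l = S ^ l * (S + (1 - S)) ^ (m - l)" by simp
  also have "\<dots> = (\<Sum>i\<le>m - l. of_nat ((m - l) choose i) * (S ^ (l + i) * (1 - S) ^ (m - l - i)))"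
    by (subst binomial_ring) (simp add: sum_distrib_left power_add mult_ac)
  also have "\<dots> = (\<Sum>j\<in>{l..m}. of_nat ((m - l) choose (j - l)) * (S ^ j * (1 - S) ^ (m - j)))"
    by (rule sum.reindex_bij_witness[of _ "\<lambda>j. j - l" "\<lambda>i. i + l"])
       (use assms in \<open>auto simp: add.commute\<close>)
  finally show ?thesis .
qed

text \<open>
  The two linear factors are \<open>s = - x / r\<close> and \<open>1 - s\<close>, so this is a Bernstein form of degree \<open>m\<close> on
  \<open>[- r, 0]\<close> whose coefficients of index greater than \<open>n\<close> vanish.
\<close>
definition bernstein_exp_poly :: "nat \<Rightarrow> nat \<Rightarrow> real \<Rightarrow> real poly" where
  "bernstein_exp_poly m n r =
     (\<Sum>j\<le>n. smult ((-1) ^ j * refl_laguerre (Suc (m - j)) j r)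
                   ([:0, - 1 / r:] ^ j * [:1, 1 / r:] ^ (m - j)))"

text \<open>
  Expand each monomial of the Taylor polynomial of order \<open>n\<close> of the exponential function in the
  Bernstein basis of degree \<open>m\<close>. The basis element of index \<open>j\<close> is divisible by \<open>x ^ j\<close>, so those
  with \<open>j > n\<close> do not affect the coefficients up to \<open>n\<close>; deleting them leaves
  \<open>bernstein_exp_poly m n r\<close>.
\<close>
lemma coeff_bernstein_exp_poly:
  assumes "k \<le> n" "n \<le> m" "r \<noteq> 0"
  shows "coeff (bernstein_exp_poly m n r) k = 1 / fact k"
proof -
  define S where "S = [:0, - 1 / r:]"
  have S1: "1 - S = [:1, 1 / r:]" by (simp add: S_def one_pCons)
  have S_pow: "S ^ l = monom ((- 1 / r) ^ l) l" for l
    by (simp add: S_def monom_power flip: monom_Suc monom_0)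
  define B where "B j = S ^ j * (1 - S) ^ (m - j)" for j
  define w where "w l j = ((- r) ^ l / fact l) * real ((m - l) choose (j - l))" for l j
  have coeff_B: "coeff (B j) k = 0" if "n < j" for j
    using that \<open>k \<le> n\<close> by (simp add: B_def S_pow coeff_monom_mult)
  have monomial: "(if l = k then 1 / fact k else 0) = (\<Sum>j\<in>{l..m}. w l j * coeff (B j) k)"
    if "l \<le> m" for l
  proof -
    have "(if l = k then 1 / fact k else 0) = coeff (monom (1 / fact l) l) k"
      by simp
    also have "monom (1 / fact l) l = smult ((- r) ^ l / fact l) (S ^ l)"
      using \<open>r \<noteq> 0\<close> by (simp add: S_pow smult_monom flip: power_mult_distrib)
    also have "S ^ l = (\<Sum>j\<in>{l..m}. smult (real ((m - l) choose (j - l))) (B j))"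
      by (subst monomial_bernstein_expansion[OF that]) (simp add: B_def of_nat_poly)
    finally show ?thesis
      by (simp only: coeff_smult coeff_sum sum_distrib_left w_def mult.assoc)
  qed
  have "1 / fact k = (\<Sum>l\<le>n. if l = k then 1 / fact k else 0)"
    using \<open>k \<le> n\<close> by simp
  also have "\<dots> = (\<Sum>l\<le>n. \<Sum>j\<in>{l..m}. w l j * coeff (B j) k)"
    using \<open>n \<le> m\<close> by (intro sum.cong monomial refl) auto
  also have "\<dots> = (\<Sum>l\<le>n. \<Sum>j\<in>{l..n}. w l j * coeff (B j) k)"
    by (intro sum.cong refl sum.mono_neutral_right) (use \<open>n \<le> m\<close> coeff_B in auto)
  also have "\<dots> = (\<Sum>j\<le>n. \<Sum>l\<le>j. w l j * coeff (B j) k)"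
  proof -
    have "(\<Sum>l\<le>n. \<Sum>j\<in>{l..n}. w l j * coeff (B j) k) =
          (\<Sum>l\<in>{..n}. \<Sum>j\<in>{j \<in> {..n}. l \<le> j}. w l j * coeff (B j) k)"
      by (intro sum.cong) auto
    also have "\<dots> = (\<Sum>j\<in>{..n}. \<Sum>l\<in>{l \<in> {..n}. l \<le> j}. w l j * coeff (B j) k)"
      by (rule sum.swap_restrict) auto
    also have "\<dots> = (\<Sum>j\<le>n. \<Sum>l\<le>j. w l j * coeff (B j) k)"
      by (intro sum.cong) auto
    finally show ?thesis .
  qed
  also have "\<dots> = (\<Sum>j\<le>n. ((-1) ^ j * refl_laguerre (Suc (m - j)) j r) * coeff (B j) k)"
  proof (rule sum.cong[OF refl])
    fix j assume "j \<in> {..n}"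
    then have "m - j + j = m" using \<open>n \<le> m\<close> by simp
    then have "(-1) ^ j * refl_laguerre (Suc (m - j)) j r = (\<Sum>l\<le>j. w l j)"
      by (simp only: refl_laguerre_binomial_sum w_def mult.assoc[symmetric] power_mult_distrib[symmetric])
         (simp add: mult.commute)
    then show "(\<Sum>l\<le>j. w l j * coeff (B j) k) =
        ((-1) ^ j * refl_laguerre (Suc (m - j)) j r) * coeff (B j) k"
      by (simp add: sum_distrib_right)
  qed
  also have "\<dots> = coeff (bernstein_exp_poly m n r) k"
    by (simp only: bernstein_exp_poly_def coeff_sum coeff_smult B_def flip: S1 S_def)
  finally show ?thesis by simp
qed

lemma bernstein_exp_poly_in_Pi_class:
  assumes "n \<le> m" "r \<noteq> 0"
  shows "bernstein_exp_poly m n r \<in> Pi_class m n"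
proof -
  define P where "P = bernstein_exp_poly m n r"
  have "degree P \<le> m"
    unfolding P_def bernstein_exp_poly_def
  proof (intro degree_sum_le order.trans[OF degree_smult_le])
    fix j assume "j \<in> {..n}"
    have "degree ([:0, - 1 / r:] ^ j) \<le> j" "degree ([:1, 1 / r:] ^ (m - j)) \<le> m - j"
      using degree_power_le[of "[:0, - 1 / r:]" j] degree_power_le[of "[:1, 1 / r:]" "m - j"]
        \<open>r \<noteq> 0\<close> by auto
    then show "degree ([:0, - 1 / r:] ^ j * [:1, 1 / r:] ^ (m - j)) \<le> m"
      using degree_mult_le[of "[:0, - 1 / r:] ^ j" "[:1, 1 / r:] ^ (m - j)"] \<open>j \<in> {..n}\<close> \<open>n \<le> m\<close>
      by auto
  qed auto
  then have "P = (\<Sum>k\<le>m. monom (coeff P k) k)"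
    by (rule poly_as_sum_of_monoms'[symmetric])
  then have "P = (\<Sum>k\<le>m. monom ((fact k * coeff P k) / fact k) k)"
    by simp
  moreover have "\<forall>k\<le>n. fact k * coeff P k = 1"
    using assms by (auto simp: P_def coeff_bernstein_exp_poly)
  ultimately show ?thesis
    unfolding Pi_class_def P_def[symmetric]
    by (intro CollectI exI[of _ "\<lambda>k. fact k * coeff P k"]) auto
qed

text \<open>The Bernstein basis is nonnegative on the interval and sums to \<open>1\<close>.\<close>
lemma abs_poly_bernstein_exp_poly_le:
  assumes "n \<le> m" "0 < r" "x \<in> {- r..0}"
    and bound: "\<And>j. j \<le> n \<Longrightarrow> \<bar>refl_laguerre (Suc (m - j)) j r\<bar> \<le> real (m choose j)"
  shows "\<bar>poly (bernstein_exp_poly m n r) x\<bar> \<le> 1"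
proof -
  define s where "s = - x / r"
  have s: "0 \<le> s" "0 \<le> 1 - s"
    using assms by (auto simp: s_def field_simps)
  have "poly (bernstein_exp_poly m n r) x =
      (\<Sum>j\<le>n. (-1) ^ j * refl_laguerre (Suc (m - j)) j r * (s ^ j * (1 - s) ^ (m - j)))"
    by (simp add: bernstein_exp_poly_def poly_sum s_def)
  also have "\<bar>\<dots>\<bar> \<le> (\<Sum>j\<le>n. real (m choose j) * (s ^ j * (1 - s) ^ (m - j)))"
  proof (rule order.trans[OF sum_abs], rule sum_mono)
    fix j assume "j \<in> {..n}"
    then show "\<bar>(-1) ^ j * refl_laguerre (Suc (m - j)) j r * (s ^ j * (1 - s) ^ (m - j))\<bar>
        \<le> real (m choose j) * (s ^ j * (1 - s) ^ (m - j))"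
      using s bound[of j] by (auto simp: abs_mult power_abs intro!: mult_right_mono)
  qed
  also have "\<dots> \<le> (\<Sum>j\<le>m. real (m choose j) * (s ^ j * (1 - s) ^ (m - j)))"
    using s \<open>n \<le> m\<close> by (intro sum_mono2) auto
  also have "\<dots> = 1"
    using binomial_ring[of s "1 - s" m] by (simp add: mult.assoc)
  finally show ?thesis .
qed

lemma parabolic_stability_radius_ge:
  assumes "P \<in> Pi_class m n" "0 < r" "\<And>x. x \<in> {- r..0} \<Longrightarrow> \<bar>poly P x\<bar> \<le> 1"
  shows "ereal r \<le> parabolic_stability_radius m n"
proof -
  have "ereal r \<le> stability_threshold P"
    unfolding stability_threshold_def using assms by (intro Sup_upper) auto
  also have "\<dots> \<le> parabolic_stability_radius m n"
    unfolding parabolic_stability_radius_def using assms(1) by (rule SUP_upper)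
  finally show ?thesis .
qed

theorem theorem9:
  fixes m n :: nat
  assumes "1 \<le> n" and "n \<le> m"
  shows "(\<exists>!\<eta>::real. \<eta> < 0 \<and> gen_laguerre n (- real m - 1) \<eta> - real (m choose n) = 0) \<and>
    (\<forall>\<eta>::real. \<eta> < 0 \<and> gen_laguerre n (- real m - 1) \<eta> - real (m choose n) = 0 \<longrightarrow>
       parabolic_stability_radius m n \<ge> ereal (- \<eta>))"
proof -
  let ?zero = "\<lambda>\<eta>::real. \<eta> < 0 \<and> gen_laguerre n (- real m - 1) \<eta> - real (m choose n) = 0"
  have zero_iff: "?zero \<eta> \<longleftrightarrow> 0 < - \<eta> \<and> refl_laguerre (Suc (m - n)) n (- \<eta>) = real (m choose n)" for \<eta>
    using gen_laguerre_eq_refl_laguerre[OF assms(2), of \<eta>] by auto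
  have "\<exists>\<eta>. ?zero \<eta>"
    unfolding zero_iff using refl_laguerre_eq_binomial_exists[OF assms] by (metis minus_minus)
  moreover have "\<eta> = \<eta>'" if "?zero \<eta>" "?zero \<eta>'" for \<eta> \<eta>'
  proof (rule linorder_cases[of "- \<eta>" "- \<eta>'"])
    show "- \<eta> < - \<eta>' \<Longrightarrow> \<eta> = \<eta>'" "- \<eta>' < - \<eta> \<Longrightarrow> \<eta> = \<eta>'"
      using that refl_laguerre_eq_binomial_unique[OF assms] unfolding zero_iff by blast+
  qed simp
  moreover have "ereal (- \<eta>) \<le> parabolic_stability_radius m n" if "?zero \<eta>" for \<eta>
  proof (rule parabolic_stability_radius_ge)
    have r: "0 < - \<eta>" "refl_laguerre (Suc (m - n)) n (- \<eta>) = real (m choose n)"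
      using that unfolding zero_iff by auto
    show "0 < - \<eta>" by fact
    show "bernstein_exp_poly m n (- \<eta>) \<in> Pi_class m n"
      using r assms by (intro bernstein_exp_poly_in_Pi_class) auto
    show "\<bar>poly (bernstein_exp_poly m n (- \<eta>)) x\<bar> \<le> 1" if "x \<in> {- (- \<eta>)..0}" for x
      using refl_laguerre_abs_le_before_zero[OF _ assms(2) r] assms(2) r(1) that
      by (intro abs_poly_bernstein_exp_poly_le) auto
  qed
  ultimately show ?thesis
    by blast
qed

end
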